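(* Let $q=2$, $m\ge 4$ an integer, and $f:\mathbb{F}_2^m\to\mathbb{F}_2$ a function satisfying the following two conditions: (1) when $1\le\mathrm{wt}(\mathbf{x})\le 2$, $f(\mathbf{x})\neq 0$ (i.e. $f(\mathbf{x})=1$); (2) $f(\mathbf{x})=0$ whenever $m$ is even and $\mathrm{wt}(\mathbf{x})\ge m-1$, or $m$ is odd and $\mathrm{wt}(\mathbf{x})\ge m-2$. Then the linear code $\mathcal{C}_f$ is minimal.
   Context: $\mathrm{wt}(\mathbf{x})$ is the Hamming weight (number of nonzero coordinates) of $\mathbf{x}\in\mathbb{F}_q^m$, and $\mathbf{x}\cdot\mathbf{y}=\sum_i x_iy_i$. For $f:\mathbb{F}_q^m\to\mathbb{F}_q$, $\mathcal{C}_f=\{(uf(\mathbf{x})+\mathbf{v}\cdot\mathbf{x})_{\mathbf{x}\in\mathbb{F}_q^m\setminus\{\mathbf{0}\}} : u\in\mathbb{F}_q,\ \mathbf{v}\in\mathbb{F}_q^m\}\subseteq\mathbb{F}_q^{q^m-1}$. The support of a vector is the set of its coordinate positions with nonzero entry. A codeword $\mathbf{c}$ of a linear code $\mathcal{C}$ is minimal if every $\mathbf{b}\in\mathcal{C}$ whose support is contained in the support of $\mathbf{c}$ equals $a\mathbf{c}$ for some $a\in\mathbb{F}_q$; the code $\mathcal{C}$ is minimal if all of its codewords are minimal. *)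

theory Defs
  imports "HOL-Analysis.Cartesian_Space" "HOL-Library.Z2"
begin

instance bit :: finite
proof
  have "(UNIV :: bit set) = {0, 1}"
    by auto
  then show "finite (UNIV :: bit set)"
    by (metis finite.emptyI finite.insertI)
qed

lemma CARD_bit: "CARD(bit) = 2"
proof -
  have "(UNIV :: bit set) = {0, 1}"
    by auto
  then have "CARD(bit) = card {0, 1 :: bit}"
    by (rule arg_cong)
  also have "\<dots> = 2"
    by (simp add: card_insert_if del: bit_not_zero_iff bit_not_one_iff)
  finally show ?thesis .
qed

definition support :: "'a::zero ^ 'n \<Rightarrow> 'n set" where
  "support x = {i. x $ i \<noteq> 0}"

definition wt :: "'a::zero ^ 'n \<Rightarrow> nat" where
  "wt x = card (support x)"

definition dot :: "'a::comm_ring_1 ^ 'n \<Rightarrow> 'a ^ 'n \<Rightarrow> 'a" where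
  "dot x y = (\<Sum>i\<in>UNIV. x $ i * y $ i)"

text \<open>
  A linear code of length \<open>CARD('n)\<close> is a subspace (\<^term>\<open>vec.subspace\<close>) of \<open>'a ^ 'n\<close>.
\<close>

definition minimal_codeword :: "('a::field ^ 'n) set \<Rightarrow> 'a ^ 'n \<Rightarrow> bool" where
  "minimal_codeword C c \<longleftrightarrow>
     c \<in> C \<and> (\<forall>b\<in>C. support b \<subseteq> support c \<longrightarrow> (\<exists>a. b = a *s c))"

definition minimal_code :: "('a::field ^ 'n) set \<Rightarrow> bool" where
  "minimal_code C \<longleftrightarrow> (\<forall>c\<in>C. minimal_codeword C c)"

text \<open>
  The coordinate positions of \<open>\<C>\<^sub>f\<close> are the nonzero vectors; taking them as an index type makes
  the codewords ordinary vectors of length \<open>q\<^sup>m - 1\<close>.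
\<close>

typedef (overloaded) ('a::field, 'm::finite) nonzero_vec = "{x :: 'a ^ 'm. x \<noteq> 0}"
proof
  show "(\<chi> i. 1) \<in> {x :: 'a ^ 'm. x \<noteq> 0}"
    by (simp add: vec_eq_iff)
qed

instance nonzero_vec :: ("{field, finite}", finite) finite
proof
  have "inj (Rep_nonzero_vec :: ('a, 'b) nonzero_vec \<Rightarrow> _)"
    by (simp add: inj_on_def Rep_nonzero_vec_inject)
  then show "finite (UNIV :: ('a, 'b) nonzero_vec set)"
    by (rule finite_imageD[OF finite, rotated])
qed

lemma CARD_nonzero_vec:
  "CARD(('a::{field, finite}, 'm::finite) nonzero_vec) = CARD('a) ^ CARD('m) - 1"
proof -
  have "CARD(('a, 'm) nonzero_vec) = card (UNIV - {0 :: 'a ^ 'm})"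
    by (simp add: type_definition.card[OF type_definition_nonzero_vec] Collect_neg_eq Compl_eq_Diff_UNIV)
  then show ?thesis
    by (simp add: card_Diff_singleton)
qed

definition code_of :: "('a::{field, finite} ^ 'm \<Rightarrow> 'a) \<Rightarrow> ('a ^ ('a, 'm) nonzero_vec) set" where
  "code_of f = {(\<chi> p. u * f (Rep_nonzero_vec p) + dot v (Rep_nonzero_vec p)) | u v. True}"

lemma code_of_subspace: "vec.subspace (code_of f)"
proof (rule vec.subspaceI)
  show "0 \<in> code_of f"
    unfolding code_of_def
    by (rule CollectI, rule exI[of _ 0], rule exI[of _ 0]) (simp add: vec_eq_iff dot_def)
next
  fix x y assume "x \<in> code_of f" "y \<in> code_of f"
  then obtain u v u' v' where
    "x = (\<chi> p. u * f (Rep_nonzero_vec p) + dot v (Rep_nonzero_vec p))"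
    "y = (\<chi> p. u' * f (Rep_nonzero_vec p) + dot v' (Rep_nonzero_vec p))"
    by (auto simp: code_of_def)
  then show "x + y \<in> code_of f"
    unfolding code_of_def
    by (intro CollectI exI[of _ "u + u'"] exI[of _ "v + v'"])
      (simp add: vec_eq_iff dot_def algebra_simps sum.distrib)
next
  fix c x assume "x \<in> code_of f"
  then obtain u v where
    "x = (\<chi> p. u * f (Rep_nonzero_vec p) + dot v (Rep_nonzero_vec p))"
    by (auto simp: code_of_def)
  then show "c *s x \<in> code_of f"
    unfolding code_of_def
    by (intro CollectI exI[of _ "c * u"] exI[of _ "c *s v"])
      (simp add: vec_eq_iff dot_def algebra_simps sum_distrib_left)
qed

end

theory Submission
  imports Defs
begin

text \<open>
  Over \<open>\<F>\<^sub>2\<close>, a code is minimal iff no two nonzero codewords have disjoint supports: if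
  \<open>b\<close> is covered by \<open>c\<close>, then \<open>b\<close> and \<open>c + b\<close> have disjoint supports. Consider two
  codewords \<open>u f + v\<sqdot>x\<close> and \<open>u' f + w\<sqdot>x\<close> with disjoint supports.
  If \<open>u = u' = 0\<close>, two nonzero linear forms always take the value 1 simultaneously.
  If \<open>u = 1\<close> and \<open>u' = 0\<close>, then \<open>f x = v\<sqdot>x\<close> wherever \<open>w\<sqdot>x = 1\<close>; the vectors of
  weight at most 2 force \<open>v = w\<close>, so \<open>f x = 1\<close> wherever \<open>w\<sqdot>x = 1\<close>, which includes a
  vector of weight at least \<open>m - 1\<close>.
  If \<open>u = u' = 1\<close>, the vectors of weight at most 2 force the pairs \<open>(v\<^sub>i, w\<^sub>i)\<close> to be
  pairwise distinct and different from \<open>(0, 0)\<close>, so that \<open>m \<le> 3\<close>.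
\<close>

lemma dot_add_right: "dot v (x + y) = dot v x + dot v y"
  by (simp add: dot_def algebra_simps sum.distrib)

lemma dot_add_left: "dot (v + w) x = dot v x + dot w x"
  by (simp add: dot_def algebra_simps sum.distrib)

lemma dot_zero_left [simp]: "dot 0 x = 0"
  by (simp add: dot_def)

lemma dot_zero_right [simp]: "dot v 0 = 0"
  by (simp add: dot_def)

lemma dot_axis [simp]: "dot v (axis i 1) = v $ i"
  by (simp add: dot_def axis_def if_distrib cong: if_cong)

lemma wt_axis [simp]: "wt (axis i 1 :: 'a::zero_neq_one ^ 'n) = 1"
proof -
  have "support (axis i 1 :: 'a ^ 'n) = {i}"
    by (auto simp: support_def axis_def)
  then show ?thesis
    by (simp add: wt_def)
qed

lemma wt_axis_add_axis:
  assumes "i \<noteq> j"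
  shows "wt (axis i 1 + axis j 1 :: 'a::{monoid_add, zero_neq_one} ^ 'n) = 2"
proof -
  have "support (axis i 1 + axis j 1 :: 'a ^ 'n) = {i, j}"
    using assms by (auto simp: support_def axis_def)
  then show ?thesis
    using assms by (simp add: wt_def)
qed

lemma wt_ones: "wt (\<chi> i. 1 :: 'a::zero_neq_one ^ 'n) = CARD('n)"
  by (simp add: wt_def support_def)

lemma wt_ones_add_axis:
  "wt ((\<chi> i. 1) + axis j 1 :: bit ^ 'n) = CARD('n) - 1"
proof -
  have "support ((\<chi> i. 1) + axis j 1 :: bit ^ 'n) = - {j}"
    by (auto simp: support_def axis_def)
  then show ?thesis
    by (simp add: wt_def Compl_eq_Diff_UNIV card_Diff_singleton)
qed

lemma wt_zero [simp]: "wt 0 = 0"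
  by (simp add: wt_def support_def)

lemma nonzero_bit_vec_entry:
  fixes w :: "bit ^ 'n"
  assumes "w \<noteq> 0"
  obtains i where "w $ i = 1"
  using assms by (metis bit_not_zero_iff vec_eq_iff zero_index)

text \<open>Choose \<open>i\<close> with \<open>v $ i = 1\<close> and \<open>j\<close> with
  \<open>w $ j = 1\<close>. If neither unit vector works, then \<open>w $ i = v $ j = 0\<close>, and
  the sum of the two works.\<close>

lemma linear_forms_common_one:
  fixes v w :: "bit ^ 'n"
  assumes "v \<noteq> 0" "w \<noteq> 0"
  obtains x where "dot v x = 1" "dot w x = 1"
proof -
  obtain i j where v: "v $ i = 1" and w: "w $ j = 1"
    using assms by (metis nonzero_bit_vec_entry)
  show thesis
  proof (cases "w $ i = 1 \<or> v $ j = 1")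
    case True
    then show thesis
      using v w that[of "axis i 1"] that[of "axis j 1"] by auto
  next
    case False
    then show thesis
      using v w that[of "axis i 1 + axis j 1"] by (simp add: dot_add_right)
  qed
qed

text \<open>Flipping a coordinate \<open>i\<close> with \<open>w $ i = 1\<close> changes the value
  of the form, so it is 1 either at the all-ones vector or at that vector with entry
  \<open>i\<close> cleared.\<close>

lemma linear_form_one_of_large_weight:
  fixes w :: "bit ^ 'n"
  assumes "w \<noteq> 0"
  obtains x where "dot w x = 1" "wt x \<ge> CARD('n) - 1"
proof -
  obtain i where i: "w $ i = 1"
    using assms by (rule nonzero_bit_vec_entry)
  show thesis
  proof (cases "dot w (\<chi> i. 1) = 1")
    case True
    then show thesis
      using that[of "\<chi> i. 1"] by (simp add: wt_ones)
  next
    case False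
    then show thesis
      using i that[of "(\<chi> i. 1) + axis i 1"] by (simp add: dot_add_right wt_ones_add_axis)
  qed
qed

lemma linear_form_not_disjoint:
  fixes f :: "bit ^ 'm \<Rightarrow> bit"
  assumes low: "\<And>x. 1 \<le> wt x \<Longrightarrow> wt x \<le> 2 \<Longrightarrow> f x = 1"
    and high: "\<And>x. wt x \<ge> CARD('m) - 1 \<Longrightarrow> f x = 0"
    and w: "w \<noteq> 0"
  obtains x where "f x + dot v x = 1" "dot w x = 1"
proof (rule ccontr)
  assume "\<not> thesis"
  then have eq: "f x = dot v x" if "dot w x = 1" for x
    using that \<open>\<And>x. f x + dot v x = 1 \<Longrightarrow> dot w x = 1 \<Longrightarrow> thesis\<close>[of x]
    by (cases "f x"; cases "dot v x") auto
  have one: "v $ i = 1" if "w $ i = 1" for i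
    using eq[of "axis i 1"] low[of "axis i 1"] that by simp
  obtain i where i: "w $ i = 1"
    using w by (rule nonzero_bit_vec_entry)
  \<comment> \<open>The form of \<open>w\<close> is 1 at the sum of the unit vectors of
    \<open>i\<close> and \<open>j\<close>, where \<open>f\<close> is 1 too; hence
    \<open>v $ i + v $ j = 1\<close>, while \<open>v $ i = 1\<close>.\<close>
  have zero: "v $ j = 0" if "w $ j = 0" for j
  proof -
    have "i \<noteq> j"
      using i that by auto
    then have "f (axis i 1 + axis j 1) = 1"
      by (intro low) (simp_all add: wt_axis_add_axis)
    then show ?thesis
      using eq[of "axis i 1 + axis j 1"] i that one[OF i]
      by (cases "v $ j") (auto simp: dot_add_right)
  qed
  have "v $ j = w $ j" for j
    using one[of j] zero[of j] by (cases "w $ j") auto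
  then have "v = w"
    by (simp add: vec_eq_iff)
  moreover obtain x where "dot w x = 1" "wt x \<ge> CARD('m) - 1"
    using w by (rule linear_form_one_of_large_weight)
  ultimately show False
    using eq[of x] high[of x] by simp
qed

lemma shifted_forms_not_disjoint:
  fixes f :: "bit ^ 'm \<Rightarrow> bit"
  assumes card: "CARD('m) \<ge> 4"
    and low: "\<And>x. 1 \<le> wt x \<Longrightarrow> wt x \<le> 2 \<Longrightarrow> f x = 1"
  obtains x where "x \<noteq> 0" "f x + dot v x = 1" "f x + dot w x = 1"
proof (rule ccontr)
  assume "\<not> thesis"
  \<comment> \<open>Here \<open>f x = 1\<close>, so each shifted form is the complement of its
    linear form.\<close>
  then have disj: "dot v x = 1 \<or> dot w x = 1" if "1 \<le> wt x" "wt x \<le> 2" for x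
    using that low[of x] \<open>\<And>x. x \<noteq> 0 \<Longrightarrow> f x + dot v x = 1 \<Longrightarrow> f x + dot w x = 1 \<Longrightarrow> thesis\<close>[of x]
    by (cases "dot v x"; cases "dot w x"; cases "x = 0") auto
  define h where "h i = (v $ i, w $ i)" for i
  have "inj h"
  proof (rule injI, rule ccontr)
    \<comment> \<open>Equal pairs cancel: both linear forms vanish at the sum of the two unit
      vectors, against \<open>disj\<close>.\<close>
    fix i j assume "h i = h j" "i \<noteq> j"
    then show False
      using disj[of "axis i 1 + axis j 1"]
      by (simp add: h_def wt_axis_add_axis dot_add_right)
  qed
  have "range h \<subseteq> {(1, 0), (0, 1), (1, 1)}"
  proof (rule image_subsetI)
    fix i
    show "h i \<in> {(1, 0), (0, 1), (1, 1)}"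
      using disj[of "axis i 1"] by (cases "v $ i"; cases "w $ i") (auto simp: h_def)
  qed
  then have "card (range h) \<le> card {(1, 0), (0, 1), (1, 1) :: bit \<times> bit}"
    by (intro card_mono) auto
  also have "\<dots> \<le> 3"
    by (simp add: card_insert_if)
  finally show False
    using card card_image[OF \<open>inj h\<close>] by simp
qed

lemma codewords_not_disjoint:
  fixes f :: "bit ^ 'm \<Rightarrow> bit"
  assumes card: "CARD('m) \<ge> 4"
    and low: "\<And>x. 1 \<le> wt x \<Longrightarrow> wt x \<le> 2 \<Longrightarrow> f x = 1"
    and high: "\<And>x. wt x \<ge> CARD('m) - 1 \<Longrightarrow> f x = 0"
    and "u \<noteq> 0 \<or> v \<noteq> 0" "u' \<noteq> 0 \<or> w \<noteq> 0"
  obtains x where "x \<noteq> 0" "u * f x + dot v x = 1" "u' * f x + dot w x = 1"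
proof (cases u; cases u')
  assume "u = 0" "u' = 0"
  moreover from this assms obtain x where "dot v x = 1" "dot w x = 1"
    by (metis linear_forms_common_one)
  moreover from this have "x \<noteq> 0" by auto
  ultimately show thesis
    using that by simp
next
  assume "u = 1" "u' = 0"
  moreover from this assms obtain x where "f x + dot v x = 1" "dot w x = 1"
    by (metis linear_form_not_disjoint)
  moreover from this have "x \<noteq> 0" by auto
  ultimately show thesis
    using that by simp
next
  assume "u = 0" "u' = 1"
  moreover from this assms obtain x where "f x + dot w x = 1" "dot v x = 1"
    by (metis linear_form_not_disjoint)
  moreover from this have "x \<noteq> 0" by auto
  ultimately show thesis
    using that by simp
next
  assume "u = 1" "u' = 1"
  \<comment> \<open>In the other cases a linear form equal to 1 excludes \<open>x = 0\<close>. Here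
    \<open>f 0\<close> may be 1, so nonzeroness has to come with the witness.\<close>
  moreover obtain x where "x \<noteq> 0" "f x + dot v x = 1" "f x + dot w x = 1"
    using card low by (rule shifted_forms_not_disjoint)
  ultimately show thesis
    using that by simp
qed

theorem theorem4p5:
  fixes f :: "bit ^ 'm::finite \<Rightarrow> bit"
  assumes "CARD('m) \<ge> 4"
    and "\<And>x. 1 \<le> wt x \<Longrightarrow> wt x \<le> 2 \<Longrightarrow> f x \<noteq> 0"
    and "\<And>x. (even CARD('m) \<and> wt x \<ge> CARD('m) - 1) \<or>
              (odd CARD('m) \<and> wt x \<ge> CARD('m) - 2) \<Longrightarrow> f x = 0"
  shows "minimal_code (code_of f)"
  unfolding minimal_code_def minimal_codeword_def
proof (intro ballI conjI impI)
  fix c b assume c: "c \<in> code_of f" and b: "b \<in> code_of f" and sub: "support b \<subseteq> support c"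
  obtain u v where c_eq: "c = (\<chi> p. u * f (Rep_nonzero_vec p) + dot v (Rep_nonzero_vec p))"
    using c by (auto simp: code_of_def)
  obtain u' w where b_eq: "b = (\<chi> p. u' * f (Rep_nonzero_vec p) + dot w (Rep_nonzero_vec p))"
    using b by (auto simp: code_of_def)
  show "\<exists>a. b = a *s c"
  \<comment> \<open>The degenerate cases are the zero parameters for \<open>b\<close> or for
    \<open>c + b\<close>, giving the scalars 0 and 1.\<close>
  proof (cases "(u' = 0 \<and> w = 0) \<or> (u + u' = 0 \<and> v + w = 0)")
    case True
    then show ?thesis
    proof
      assume "u' = 0 \<and> w = 0"
      then have "b $ p = (0 *s c) $ p" for p
        by (simp add: b_eq)
      then have "b = 0 *s c"
        by (metis vec_eq_iff)
      then show ?thesis ..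
    next
      assume *: "u + u' = 0 \<and> v + w = 0"
      then have "u = u'"
        by (cases u; cases u') auto
      moreover have "v $ i = w $ i" for i
        using * vector_add_component[of v w i] by (cases "v $ i"; cases "w $ i") auto
      ultimately have "b = 1 *s c"
        by (simp add: b_eq c_eq dot_def)
      then show ?thesis ..
    qed
  next
    case False
    have low: "f x = 1" if "1 \<le> wt x" "wt x \<le> 2" for x
      using assms(2)[OF that] by simp
    have high: "f x = 0" if "wt x \<ge> CARD('m) - 1" for x
      using assms(3)[of x] that by linarith
    \<comment> \<open>Applied to \<open>b\<close> and \<open>c + b\<close>: at a position where both
      are 1, \<open>c\<close> is 0, so \<open>b\<close> is not covered by \<open>c\<close>.\<close>
    obtain x where x: "x \<noteq> 0" "u' * f x + dot w x = 1" "(u + u') * f x + dot (v + w) x = 1"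
      using codewords_not_disjoint[where f = f and u = u' and v = w and u' = "u + u'" and w = "v + w",
          OF assms(1) low high] False
      by blast
    define p where "p = (Abs_nonzero_vec x :: (bit, 'm) nonzero_vec)"
    have p: "Rep_nonzero_vec p = x"
      using x(1) by (simp add: p_def Abs_nonzero_vec_inverse)
    have "b $ p = 1"
      using x(2) by (simp add: b_eq p)
    moreover have "c $ p + b $ p = 1"
      using x(3) by (simp only: b_eq c_eq p vec_lambda_beta dot_add_left distrib_left ac_simps)
    ultimately have "p \<in> support b" "p \<notin> support c"
      by (cases "c $ p"; simp add: support_def)+
    then show ?thesis
      using sub by blast
  qed
qed

end
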